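(* Let $\mathrm{FSR}(f)$ be an $n$-stage FSR, and let $\mathrm{FSR}(g)$ be an $m$-stage FSR, with transition functions $\tilde{f}:\mathbb{F}_2^n\to\mathbb{F}_2^n$ and $\tilde{g}:\mathbb{F}_2^m\to\mathbb{F}_2^m$. Let $\vec{t}=(0,\ldots,0,1)^T\in\mathbb{F}_2^m$, and denote by $\rho(\vec{t}):\mathbb{F}_2^m\to\mathbb{F}_2^m$ the translation $\vec{v}\mapsto\vec{v}+\vec{t}$. Denote by $\pi_1:\mathbb{F}_2^n\to\mathbb{F}_2$ the projection onto the first coordinate. Then, identifying $\mathbb{F}_2^{m+n}$ with $\mathbb{F}_2^m\times\mathbb{F}_2^n$, the transition function $\tilde{f}\ast\tilde{g}$ of the cascaded connection $\mathrm{FSR}(f;g)$ is equal to the wreath product element $$\tilde{f}\cdot\left(\tilde{g}\,\rho(\vec{t})^{\pi_1(\vec{y})}\right)_{\vec{y}\in\mathbb{F}_2^n}\in\left((\mathbb{F}_2^m)^{(\mathbb{F}_2^m)}\right)\wr\left((\mathbb{F}_2^n)^{(\mathbb{F}_2^n)}\right).$$ Moreover, if both $\mathrm{FSR}(f)$ and $\mathrm{FSR}(g)$ are periodic, then so is $\mathrm{FSR}(f;g)$, and $\tilde{f}\ast\tilde{g}$ then lies in the permutational imprimitive wreath product $\mathrm{Sym}(\mathbb{F}_2^m)\wr\mathrm{Sym}(\mathbb{F}_2^n)$.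
   Context: FSRs. An $n$-stage feedback shift register $\mathrm{FSR}(f)$ with characteristic function $f(x_0,\ldots,x_n)=f_1(x_0,\ldots,x_{n-1})+x_n$, where $f_1:\mathbb{F}_2^n\to\mathbb{F}_2$ is a Boolean function (the update function), has transition function $\tilde{f}:\mathbb{F}_2^n\to\mathbb{F}_2^n$, $(x_0,\ldots,x_{n-1})\mapsto(x_1,\ldots,x_{n-1},f_1(x_0,\ldots,x_{n-1}))$; likewise for $g$ with update function $g_1:\mathbb{F}_2^m\to\mathbb{F}_2$. The cascaded connection $\mathrm{FSR}(f;g)$ has transition function $\tilde{f}\ast\tilde{g}:\mathbb{F}_2^{m+n}\to\mathbb{F}_2^{m+n}$, $$(x_0,\ldots,x_{m-1},y_0,\ldots,y_{n-1})\mapsto(x_1,\ldots,x_{m-1},\,g_1(x_0,\ldots,x_{m-1})+y_0,\,y_1,\ldots,y_{n-1},\,f_1(y_0,\ldots,y_{n-1})).$$ An FSR (or cascaded connection) is called periodic if it always returns to any chosen initial state after a suitable number of iterations; equivalently, if its transition function is a permutation of its state space. Wreath products. Function values are written $x^h=h(x)$, and products of functions are composed from left to right: $\tilde{g}\rho(\vec{t})$ means first $\tilde{g}$, then $\rho(\vec{t})$; the exponent $\pi_1(\vec{y})\in\{0,1\}$ means that $\rho(\vec{t})^0=\mathrm{id}$ and $\rho(\vec{t})^1=\rho(\vec{t})$. For a set $X$, $X^X$ (also written $X^{(X)}$) denotes the semigroup of all functions $X\to X$ under composition. For sets $X,\Omega$, a subsemigroup $G$ of $X^X$ and a subsemigroup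 $P$ of $\Omega^\Omega$, the (imprimitive) wreath product $G\wr P$ consists of all functions $X\times\Omega\to X\times\Omega$ of the form $$\sigma\cdot(h_\omega)_{\omega\in\Omega}:\ (x,\omega)\mapsto(x^{h_{\omega^\sigma}},\omega^\sigma),\qquad \sigma\in P,\ h_\omega\in G\ (\omega\in\Omega),$$ i.e. first $(x,\omega)\mapsto(x,\omega^\sigma)$, then $(x,\omega)\mapsto(x^{h_\omega},\omega)$. When $G\le\mathrm{Sym}(X)$ and $P\le\mathrm{Sym}(\Omega)$ are permutation groups, $G\wr P\le\mathrm{Sym}(X\times\Omega)$ is the permutational imprimitive wreath product. Here $X=\mathbb{F}_2^m$ and $\Omega=\mathbb{F}_2^n$.
   Formalization: The wreath element is taken as (x,ω) ↦ (x^{h_ω}, ω^σ), the family indexed by the old ω rather than by ω^σ; with ω^σ the displayed equality fails, e.g. for m=n=1, g_1(x)=x, f_1(y)=y+1. For permutation groups both conventions give the same wreath product. *)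

theory Defs
  imports "HOL-Library.Z2" "HOL-Algebra.Bij" "Jordan_Normal_Form.Matrix"
begin

text \<open>Self-maps of a set \<^term>\<open>X\<close> are extensional functions: the semigroup of all of them is
  \<^term>\<open>X \<rightarrow>\<^sub>E X\<close>, and the symmetric group is \<^term>\<open>Bij X\<close>.\<close>

abbreviation F2 :: "nat \<Rightarrow> bit vec set" where
  "F2 n \<equiv> carrier_vec n"


subsection \<open>Feedback shift registers\<close>

text \<open>An n-stage register with characteristic function
  \<open>f(x_0,...,x_n) = f1(x_0,...,x_{n-1}) + x_n\<close> is given by its update function \<open>f1\<close>, of which only
  the values on \<^term>\<open>F2 n\<close> matter.\<close>

definition fsr_trans :: "nat \<Rightarrow> (bit vec \<Rightarrow> bit) \<Rightarrow> bit vec \<Rightarrow> bit vec" where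
  "fsr_trans n f1 =
     (\<lambda>x\<in>F2 n. vec n (\<lambda>i. if i < n - 1 then x $ (i + 1) else f1 x))"

text \<open>A state of the cascaded connection is \<open>z = (x_0,...,x_{m-1},y_0,...,y_{n-1})\<close>; in particular
  \<open>y_0\<close> is \<open>z $ m\<close>.\<close>

definition cascade_trans ::
  "nat \<Rightarrow> nat \<Rightarrow> (bit vec \<Rightarrow> bit) \<Rightarrow> (bit vec \<Rightarrow> bit) \<Rightarrow> bit vec \<Rightarrow> bit vec" where
  "cascade_trans m n f1 g1 =
     (\<lambda>z\<in>F2 (m + n). vec (m + n) (\<lambda>i.
        if i = m - 1 then g1 (vec_first z m) + z $ m
        else if i = m + n - 1 then f1 (vec_last z n)
        else z $ (i + 1)))"

definition periodic_on :: "'a set \<Rightarrow> ('a \<Rightarrow> 'a) \<Rightarrow> bool" where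
  "periodic_on S F \<longleftrightarrow> (\<forall>s\<in>S. \<exists>k>0. (F ^^ k) s = s)"

definition translation :: "nat \<Rightarrow> bit vec \<Rightarrow> bit vec \<Rightarrow> bit vec" where
  "translation m t = (\<lambda>v\<in>F2 m. v + t)"

text \<open>Transport of a self-map of \<^term>\<open>F2 (m + n)\<close> along the identification of
  \<^term>\<open>F2 (m + n)\<close> with \<^term>\<open>F2 m \<times> F2 n\<close>.\<close>

definition on_pairs ::
  "nat \<Rightarrow> nat \<Rightarrow> (bit vec \<Rightarrow> bit vec) \<Rightarrow> bit vec \<times> bit vec \<Rightarrow> bit vec \<times> bit vec" where
  "on_pairs m n F =
     (\<lambda>p\<in>F2 m \<times> F2 n. let z = F (fst p @\<^sub>v snd p) in (vec_first z m, vec_last z n))"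


subsection \<open>Imprimitive wreath products\<close>

text \<open>The element \<open>\<sigma> \<cdot> (h_\<omega>)\<close> acts by \<open>(x, \<omega>) \<mapsto> (h_\<omega>(x), \<sigma>(\<omega>))\<close>: the family is indexed by the old
  value of the second component. Since the cascaded connection adds the output \<open>y_0\<close> of the old
  state, the family with exponent \<open>\<pi>_1(y) = y_0\<close> requires this convention. Indexing by the new value
  \<open>\<sigma>(\<omega>)\<close> instead, as in \<open>wreath_elem_new\<close> below, gives the same wreath product over permutations
  (up to reindexing the family, see \<open>wreath_prod_permutations\<close>). Over arbitrary maps it does not: if
  \<open>f1 = 0\<close>, the states \<open>(0,0,...,0)\<close> and \<open>(1,0,...,0)\<close> have the same image under the transition
  function, but act differently on the first component.\<close>

definition wreath_elem ::
  "'a set \<Rightarrow> 'b set \<Rightarrow> ('b \<Rightarrow> 'b) \<Rightarrow> ('b \<Rightarrow> 'a \<Rightarrow> 'a) \<Rightarrow> 'a \<times> 'b \<Rightarrow> 'a \<times> 'b" where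
  "wreath_elem X \<Omega> \<sigma> h = (\<lambda>p\<in>X \<times> \<Omega>. (h (snd p) (fst p), \<sigma> (snd p)))"

definition wreath_prod ::
  "'a set \<Rightarrow> 'b set \<Rightarrow> ('a \<Rightarrow> 'a) set \<Rightarrow> ('b \<Rightarrow> 'b) set \<Rightarrow> ('a \<times> 'b \<Rightarrow> 'a \<times> 'b) set" where
  "wreath_prod X \<Omega> G P = {wreath_elem X \<Omega> \<sigma> h | \<sigma> h. \<sigma> \<in> P \<and> h \<in> \<Omega> \<rightarrow> G}"

definition wreath_elem_new ::
  "'a set \<Rightarrow> 'b set \<Rightarrow> ('b \<Rightarrow> 'b) \<Rightarrow> ('b \<Rightarrow> 'a \<Rightarrow> 'a) \<Rightarrow> 'a \<times> 'b \<Rightarrow> 'a \<times> 'b" where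
  "wreath_elem_new X \<Omega> \<sigma> h = (\<lambda>p\<in>X \<times> \<Omega>. (h (\<sigma> (snd p)) (fst p), \<sigma> (snd p)))"

lemma wreath_prod_permutations:
  assumes "P \<subseteq> Bij \<Omega>"
  shows "wreath_prod X \<Omega> G P = {wreath_elem_new X \<Omega> \<sigma> h | \<sigma> h. \<sigma> \<in> P \<and> h \<in> \<Omega> \<rightarrow> G}"
proof (intro equalityI subsetI)
  fix F assume "F \<in> wreath_prod X \<Omega> G P"
  then obtain \<sigma> h where F: "F = wreath_elem X \<Omega> \<sigma> h" and s: "\<sigma> \<in> P" and h: "h \<in> \<Omega> \<rightarrow> G"
    by (auto simp: wreath_prod_def)
  have b: "bij_betw \<sigma> \<Omega> \<Omega>" using s assms by (auto simp: Bij_def)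
  define k where "k = h \<circ> inv_into \<Omega> \<sigma>"
  have "k \<in> \<Omega> \<rightarrow> G"
    using h bij_betw_apply[OF bij_betw_inv_into[OF b]] by (auto simp: k_def)
  moreover have "F = wreath_elem_new X \<Omega> \<sigma> k"
    using bij_betw_inv_into_left[OF b]
    by (auto simp: F wreath_elem_def wreath_elem_new_def k_def restrict_def)
  ultimately show "F \<in> {wreath_elem_new X \<Omega> \<sigma> h | \<sigma> h. \<sigma> \<in> P \<and> h \<in> \<Omega> \<rightarrow> G}"
    using s by blast
next
  fix F assume "F \<in> {wreath_elem_new X \<Omega> \<sigma> h | \<sigma> h. \<sigma> \<in> P \<and> h \<in> \<Omega> \<rightarrow> G}"
  then obtain \<sigma> h where F: "F = wreath_elem_new X \<Omega> \<sigma> h" and s: "\<sigma> \<in> P" and h: "h \<in> \<Omega> \<rightarrow> G"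
    by auto
  have b: "\<sigma> \<in> \<Omega> \<rightarrow> \<Omega>" using s assms Bij_imp_funcset by blast
  have "F = wreath_elem X \<Omega> \<sigma> (h \<circ> \<sigma>)"
    by (auto simp: F wreath_elem_def wreath_elem_new_def restrict_def)
  moreover have "h \<circ> \<sigma> \<in> \<Omega> \<rightarrow> G" using b h by auto
  ultimately show "F \<in> wreath_prod X \<Omega> G P" using s by (auto simp: wreath_prod_def)
qed

end

theory Submission
  imports Defs "HOL-Combinatorics.Permutations"
begin

text \<open>In the cascade the second register runs autonomously, while the first one makes its own step
  and then has the output bit \<^term>\<open>y $ 0\<close> of the second register added to its last coordinate,
  that is, it is translated by \<^term>\<open>unit_vec m (m - 1)\<close> precisely when that bit is 1. This is
  the action of the wreath product element, and comparing coordinates proves it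
  (\<open>on_pairs_cascade_trans\<close>).

  For the second part, periodicity of a self-map of a finite set means bijectivity
  (\<open>periodic_on_iff_bij_betw\<close>). Translations are bijective, so if both registers are periodic, then
  the wreath product element has all its components in the symmetric groups. It is then itself
  bijective (\<open>bij_betw_wreath_elem\<close>). Since the identification of the state space with the product
  is bijective, the cascade is a permutation too, and therefore periodic.\<close>

section \<open>Periodic self-maps of finite sets\<close>

lemma funpow_mem:
  assumes "F \<in> S \<rightarrow> S" "s \<in> S"
  shows "(F ^^ k) s \<in> S"
  using assms by (induction k) auto

text \<open>A state that is returned to after \<open>k > 0\<close> steps is the image of the state reached after
  \<open>k - 1\<close> steps, so a periodic map is surjective. Conversely, all cycles of a permutation
  of a finite set are finite.\<close>

lemma periodic_on_iff_bij_betw: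
  assumes fin: "finite S" and F: "F \<in> S \<rightarrow> S"
  shows "periodic_on S F \<longleftrightarrow> bij_betw F S S"
proof
  assume per: "periodic_on S F"
  have "S \<subseteq> F ` S"
  proof
    fix s assume s: "s \<in> S"
    then obtain k where "k > 0" and k: "(F ^^ k) s = s"
      using per by (auto simp: periodic_on_def)
    then obtain j where "k = Suc j" using gr0_implies_Suc by blast
    with k have "s = F ((F ^^ j) s)" by simp
    then show "s \<in> F ` S" using funpow_mem[OF F s] by blast
  qed
  then have "F ` S = S" using F by blast
  then show "bij_betw F S S"
    using eq_card_imp_inj_on[OF fin, of F] by (simp add: bij_betw_def)
next
  assume bij: "bij_betw F S S"
  \<comment> \<open>That all cycles are finite is known for maps of the whole type that move only finitely many
    points, hence the extension by the identity.\<close>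
  define p where "p s = (if s \<in> S then F s else s)" for s
  have "bij_betw p S S" using bij by (simp add: p_def cong: bij_betw_cong)
  then have "p permutes S" by (rule bij_imp_permutes) (simp add: p_def)
  then have "permutation p" using fin by (rule permutes_imp_permutation[rotated])
  then have "\<exists>k>0. (p ^^ k) s = s" for s using permutation_self by metis
  moreover have "(F ^^ j) s = (p ^^ j) s" if "s \<in> S" for j s
  proof (induction j)
    case (Suc j)
    then show ?case using funpow_mem[OF F that, of j] by (simp add: p_def)
  qed simp
  ultimately show "periodic_on S F" by (simp add: periodic_on_def)
qed

section \<open>Bijective wreath product elements\<close>

text \<open>The second component of the image determines \<open>\<omega>\<close>, and with \<open>\<omega>\<close> fixed, the first component is
  changed by a single bijection \<open>h \<omega>\<close>.\<close>

lemma bij_betw_wreath_elem: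
  assumes s: "bij_betw \<sigma> \<Omega> \<Omega>" and h: "\<And>\<omega>. \<omega> \<in> \<Omega> \<Longrightarrow> bij_betw (h \<omega>) X X"
  shows "bij_betw (wreath_elem X \<Omega> \<sigma> h) (X \<times> \<Omega>) (X \<times> \<Omega>)"
proof (rule bij_betw_imageI)
  show "inj_on (wreath_elem X \<Omega> \<sigma> h) (X \<times> \<Omega>)"
  proof (rule inj_onI)
    fix p q assume p: "p \<in> X \<times> \<Omega>" and q: "q \<in> X \<times> \<Omega>"
      and eq: "wreath_elem X \<Omega> \<sigma> h p = wreath_elem X \<Omega> \<sigma> h q"
    have "\<sigma> (snd p) = \<sigma> (snd q)" and 1: "h (snd p) (fst p) = h (snd q) (fst q)"
      using eq p q by (auto simp: wreath_elem_def)
    then have 2: "snd p = snd q"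
      using p q bij_betw_imp_inj_on[OF s] by (auto dest: inj_onD)
    then have "fst p = fst q"
      using 1 p q bij_betw_imp_inj_on[OF h[of "snd q"]] by (auto dest: inj_onD)
    with 2 show "p = q" by (simp add: prod_eq_iff)
  qed
  show "wreath_elem X \<Omega> \<sigma> h ` (X \<times> \<Omega>) = X \<times> \<Omega>"
  proof (intro equalityI subsetI)
    fix q assume "q \<in> wreath_elem X \<Omega> \<sigma> h ` (X \<times> \<Omega>)"
    then show "q \<in> X \<times> \<Omega>"
      using bij_betwE[OF s] bij_betwE[OF h] by (auto simp: wreath_elem_def)
  next
    fix q assume q: "q \<in> X \<times> \<Omega>"
    then obtain \<omega> where w: "\<omega> \<in> \<Omega>" "\<sigma> \<omega> = snd q"
      using bij_betw_imp_surj_on[OF s] by (metis imageE mem_Times_iff)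
    then obtain x where "x \<in> X" "h \<omega> x = fst q"
      using q bij_betw_imp_surj_on[OF h] by (metis imageE mem_Times_iff)
    with w have "(x, \<omega>) \<in> X \<times> \<Omega>" "wreath_elem X \<Omega> \<sigma> h (x, \<omega>) = q"
      by (auto simp: wreath_elem_def)
    then show "q \<in> wreath_elem X \<Omega> \<sigma> h ` (X \<times> \<Omega>)" by blast
  qed
qed

section \<open>State spaces and translations\<close>

lemma finite_F2: "finite (F2 n)"
proof (rule finite_subset)
  have bit: "(UNIV :: bit set) = {0, 1}"
    using bit.exhaust by auto
  show "finite (vec_of_list ` {xs. set xs \<subseteq> (UNIV :: bit set) \<and> length xs = n})"
    by (intro finite_imageI finite_lists_length_eq) (simp add: bit)
  show "F2 n \<subseteq> vec_of_list ` {xs. set xs \<subseteq> UNIV \<and> length xs = n}"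
  proof
    fix v :: "bit vec" assume "v \<in> F2 n"
    then show "v \<in> vec_of_list ` {xs. set xs \<subseteq> UNIV \<and> length xs = n}"
      by (intro image_eqI[of _ _ "list_of_vec v"]) (auto simp: vec_list)
  qed
qed

lemma vec_first_append:
  "x \<in> carrier_vec m \<Longrightarrow> vec_first (x @\<^sub>v y) m = x"
  by (rule eq_vecI) (auto simp: vec_first_def)

lemma vec_last_append:
  "y \<in> carrier_vec n \<Longrightarrow> vec_last (x @\<^sub>v y) n = y"
  by (rule eq_vecI) (auto simp: vec_last_def)

text \<open>The two halves of a state determine it.\<close>

lemma inj_on_if_inj_on_on_pairs:
  assumes inj: "inj_on (on_pairs m n F) (F2 m \<times> F2 n)"
  shows "inj_on F (F2 (m + n))"
proof (rule inj_onI)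
  fix z w assume z: "z \<in> F2 (m + n)" and w: "w \<in> F2 (m + n)" and "F z = F w"
  then have "on_pairs m n F (vec_first z m, vec_last z n)
           = on_pairs m n F (vec_first w m, vec_last w n)"
    by (simp add: on_pairs_def)
  then have "(vec_first z m, vec_last z n) = (vec_first w m, vec_last w n)"
    using inj by (auto dest: inj_onD)
  then show "z = w"
    using vec_first_last_append[OF z] vec_first_last_append[OF w] by (metis prod.inject)
qed

lemma fsr_trans_extensional_funcset: "fsr_trans n f1 \<in> F2 n \<rightarrow>\<^sub>E F2 n"
  by (auto simp: fsr_trans_def)

lemma translation_Bij:
  assumes t: "t \<in> F2 m"
  shows "translation m t \<in> Bij (F2 m)"
proof -
  \<comment> \<open>In characteristic 2, every translation is its own inverse.\<close>
  have inverse: "v + t + t = v" if "v \<in> F2 m" for v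
    using that t by (intro eq_vecI) (auto simp: add.assoc)
  have "translation m t ` F2 m \<subseteq> F2 m"
    using t by (auto simp: translation_def)
  moreover have "translation m t (translation m t v) = v" if "v \<in> F2 m" for v
    unfolding translation_def using that t by (simp only: restrict_apply' add_carrier_vec inverse)
  ultimately have "bij_betw (translation m t) (F2 m) (F2 m)"
    by (intro bij_betw_byWitness[where f' = "translation m t"]) auto
  then show ?thesis by (simp add: Bij_def translation_def)
qed

text \<open>The exponent 0 gives the identity of the whole type, which is not extensional; the restricted
  composition takes care of that.\<close>

lemma compose_translation_power_Bij:
  assumes t: "t \<in> F2 m" and g: "g \<in> Bij (F2 m)"
  shows "compose (F2 m) (translation m t ^^ of_bit b) g \<in> Bij (F2 m)"
proof (cases "b = 0")
  case True
  have "compose (F2 m) id g = g"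
    using Bij_imp_extensional[OF g] by (auto simp: compose_def extensional_def)
  then show ?thesis using g True by simp
next
  case False
  then show ?thesis using compose_Bij[OF translation_Bij[OF t] g] by simp
qed

lemma compose_translation_power_funcset:
  assumes t: "t \<in> F2 m" and g: "g \<in> F2 m \<rightarrow>\<^sub>E F2 m"
  shows "compose (F2 m) (translation m t ^^ of_bit b) g \<in> F2 m \<rightarrow>\<^sub>E F2 m"
  using g t by (cases b) (auto simp: compose_def translation_def PiE_def Pi_def)

section \<open>The cascaded connection\<close>

text \<open>The two descriptions of the cascade differ only in coordinate \<open>m - 1\<close>: the output bit is added
  there to the feedback of the first register, and the translation vector vanishes elsewhere.\<close>

lemma cascade_trans_append:
  assumes "0 < m" "0 < n" and x: "x \<in> F2 m" and y: "y \<in> F2 n"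
  shows "cascade_trans m n f1 g1 (x @\<^sub>v y) =
    compose (F2 m) (translation m (unit_vec m (m - 1)) ^^ of_bit (y $ 0)) (fsr_trans m g1) x
      @\<^sub>v fsr_trans n f1 y"
  (is "?l = ?u @\<^sub>v ?v")
proof (rule eq_vecI)
  have w: "fsr_trans m g1 x \<in> F2 m"
    using PiE_mem[OF fsr_trans_extensional_funcset x] .
  \<comment> \<open>A translation vector scaled by the bit replaces the power of a map, so that the coordinates
    can be compared without splitting on the bit.\<close>
  have "?u = (if y $ 0 = 0 then fsr_trans m g1 x else fsr_trans m g1 x + unit_vec m (m - 1))"
    using x w by (simp add: compose_def translation_def)
  also have "\<dots> = fsr_trans m g1 x + vec m (\<lambda>i. if i = m - 1 then y $ 0 else 0)"
    using w by (intro eq_vecI) (auto simp: unit_vec_def)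
  finally have u: "?u = fsr_trans m g1 x + vec m (\<lambda>i. if i = m - 1 then y $ 0 else 0)" .
  have z: "x @\<^sub>v y \<in> F2 (m + n)" using x y by simp
  show "dim_vec ?l = dim_vec (?u @\<^sub>v ?v)"
    using z x y by (simp only: u) (simp add: cascade_trans_def fsr_trans_def)
  fix i assume "i < dim_vec (?u @\<^sub>v ?v)"
  then have i: "i < m + n" using x y by (simp only: u) (simp add: fsr_trans_def)
  show "?l $ i = (?u @\<^sub>v ?v) $ i"
    using assms i z
    by (simp only: u) (auto simp: cascade_trans_def fsr_trans_def vec_first_append vec_last_append Suc_diff_le)
qed

lemma on_pairs_cascade_trans:
  assumes "0 < m" "0 < n"
  shows "on_pairs m n (cascade_trans m n f1 g1) =
    wreath_elem (F2 m) (F2 n) (fsr_trans n f1)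
      (\<lambda>y. compose (F2 m) (translation m (unit_vec m (m - 1)) ^^ of_bit (y $ 0)) (fsr_trans m g1))"
proof -
  define h where "h = (\<lambda>y. compose (F2 m)
    (translation m (unit_vec m (m - 1)) ^^ of_bit (y $ 0)) (fsr_trans m g1))"
  have "h y x \<in> F2 m" if "x \<in> F2 m" for x y
    unfolding h_def
    by (rule PiE_mem[OF compose_translation_power_funcset[OF unit_vec_carrier
            fsr_trans_extensional_funcset] that])
  moreover have "fsr_trans n f1 y \<in> F2 n" if "y \<in> F2 n" for y
    using PiE_mem[OF fsr_trans_extensional_funcset that] .
  moreover have "cascade_trans m n f1 g1 (x @\<^sub>v y) = h y x @\<^sub>v fsr_trans n f1 y"
    if "x \<in> F2 m" "y \<in> F2 n" for x y
    unfolding h_def by (rule cascade_trans_append[OF assms that])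
  ultimately have "on_pairs m n (cascade_trans m n f1 g1) =
      wreath_elem (F2 m) (F2 n) (fsr_trans n f1) h"
    unfolding on_pairs_def wreath_elem_def
    by (intro restrict_ext) (auto simp: vec_first_append vec_last_append)
  then show ?thesis by (simp only: h_def)
qed

theorem proposition2p4:
  fixes m n :: nat and f1 g1 :: "bit vec \<Rightarrow> bit"
  assumes "0 < m" and "0 < n"
  shows "on_pairs m n (cascade_trans m n f1 g1) =
           wreath_elem (F2 m) (F2 n) (fsr_trans n f1)
             (\<lambda>y. compose (F2 m) (translation m (unit_vec m (m - 1)) ^^ of_bit (y $ 0))
                    (fsr_trans m g1))
       \<and> wreath_elem (F2 m) (F2 n) (fsr_trans n f1)
             (\<lambda>y. compose (F2 m) (translation m (unit_vec m (m - 1)) ^^ of_bit (y $ 0))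
                    (fsr_trans m g1))
           \<in> wreath_prod (F2 m) (F2 n) (F2 m \<rightarrow>\<^sub>E F2 m) (F2 n \<rightarrow>\<^sub>E F2 n)
       \<and> (periodic_on (F2 n) (fsr_trans n f1) \<and> periodic_on (F2 m) (fsr_trans m g1)
           \<longrightarrow> periodic_on (F2 (m + n)) (cascade_trans m n f1 g1)
             \<and> on_pairs m n (cascade_trans m n f1 g1)
                 \<in> wreath_prod (F2 m) (F2 n) (Bij (F2 m)) (Bij (F2 n)))"
  (is "?F = wreath_elem ?X ?Y ?s ?h \<and> _")
proof (intro conjI impI)
  show eq: "?F = wreath_elem ?X ?Y ?s ?h"
    by (rule on_pairs_cascade_trans[OF assms])
  have "?h \<in> ?Y \<rightarrow> (?X \<rightarrow>\<^sub>E ?X)"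
    by (intro Pi_I compose_translation_power_funcset unit_vec_carrier fsr_trans_extensional_funcset)
  then show "wreath_elem ?X ?Y ?s ?h \<in> wreath_prod ?X ?Y (?X \<rightarrow>\<^sub>E ?X) (?Y \<rightarrow>\<^sub>E ?Y)"
    unfolding wreath_prod_def using fsr_trans_extensional_funcset by blast
  assume per: "periodic_on ?Y ?s \<and> periodic_on ?X (fsr_trans m g1)"
  have Bij: "fsr_trans k u \<in> Bij (F2 k)" if "periodic_on (F2 k) (fsr_trans k u)" for k u
  proof -
    have "fsr_trans k u \<in> F2 k \<rightarrow> F2 k" "fsr_trans k u \<in> extensional (F2 k)"
      using fsr_trans_extensional_funcset[of k u] by (auto simp: PiE_def)
    then show ?thesis
      using that periodic_on_iff_bij_betw[OF finite_F2] by (simp add: Bij_def)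
  qed
  have s: "?s \<in> Bij ?Y" using per Bij by blast
  have h: "?h y \<in> Bij ?X" for y
    using per Bij by (intro compose_translation_power_Bij unit_vec_carrier) blast
  show "?F \<in> wreath_prod ?X ?Y (Bij ?X) (Bij ?Y)"
    unfolding eq wreath_prod_def using s h by blast
  have "bij_betw ?F (?X \<times> ?Y) (?X \<times> ?Y)"
    unfolding eq using s h by (intro bij_betw_wreath_elem) (auto simp: Bij_def)
  then have inj: "inj_on (cascade_trans m n f1 g1) (F2 (m + n))"
    by (intro inj_on_if_inj_on_on_pairs bij_betw_imp_inj_on)
  have maps: "cascade_trans m n f1 g1 \<in> F2 (m + n) \<rightarrow> F2 (m + n)"
    by (auto simp: cascade_trans_def)
  then have "bij_betw (cascade_trans m n f1 g1) (F2 (m + n)) (F2 (m + n))"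
    using inj endo_inj_surj[OF finite_F2] by (auto simp: bij_betw_def image_subset_iff_funcset)
  then show "periodic_on (F2 (m + n)) (cascade_trans m n f1 g1)"
    using periodic_on_iff_bij_betw[OF finite_F2 maps] by blast
qed

end
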